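(* Let $(\Lambda^*\mathcal{A},\mathbf{d})$ be a symmetric lattice reduction on $\mathcal{L}$ (as defined in the context) whose graph has no opposite edges, i.e. $\mathbf{b}_{m,p,m}=0$ in $\Lambda^2\mathcal{A}$ for all $m,p\in\mathcal{L}$. Then $$\{\Theta^{v_j},\Theta^{v_k}\}:=\Theta^{v_j}\Theta^{v_k}+\Theta^{v_k}\Theta^{v_j}=0\qquad\text{for all } j,k\in[n]\cup[n]'.$$
   Context: Lattice. Let $v_1,\dots,v_n$ be linearly independent vectors in $\mathbb{R}^n$ and $\mathcal{L}=\mathbb{Z}v_1+\dots+\mathbb{Z}v_n\cong\mathbb{Z}^n$. Put $[n]=\{1,\dots,n\}$, $[n]'=\{1',\dots,n'\}$ (disjoint copies, with $(j')'=j$) and $v_{j'}=-v_j$ for $j\in[n]$. Let $\mathcal{A}$ be the algebra of all functions $f:\mathcal{L}\to\mathbb{C}$ with pointwise operations, and let $\mathbf{b}_m\in\mathcal{A}$ be the delta function at $m$, $\mathbf{b}_m(p)=\delta_{mp}$. Universal calculus. For $r\ge 0$ let $\Omega^r$ be the space of all formal, possibly infinite, complex linear combinations of symbols $\mathbf{b}_{m^0,\dots,m^r}$ with $m^i\in\mathcal{L}$ and $m^{i}\neq m^{i+1}$ for all $i$; by convention $\mathbf{b}_{m^0,\dots,m^r}=0$ if two consecutive indices coincide. Thus $\Omega^0=\mathcal{A}$, where $f=\sum_m f(m)\mathbf{b}_m$. The product on $\Omega^*=\bigoplus_r\Omega^r$ is concatenation, $\mathbf{b}_{m^0,\dots,m^r}\,\mathbf{b}_{p^0,\dots,p^s}=\delta_{m^r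 p^0}\,\mathbf{b}_{m^0,\dots,m^r,p^1,\dots,p^s}$, extended to infinite combinations (this is well defined coefficientwise). The exterior derivative is $$\mathbf{d}\,\mathbf{b}_{m^0,\dots,m^r}=\sum_{l\in\mathcal{L}}\sum_{s=0}^{r+1}(-1)^s\,\mathbf{b}_{m^0,\dots,m^{s-1},l,m^s,\dots,m^r},$$ extended to infinite combinations (also well defined coefficientwise). It satisfies $\mathbf{d}^2=0$ and the graded Leibniz rule $\mathbf{d}(\omega_r\omega_s)=(\mathbf{d}\omega_r)\omega_s+(-1)^r\omega_r\,\mathbf{d}\omega_s$ for $\omega_r\in\Omega^r$ and $\omega_s\in\Omega^s$. Symmetric lattice reduction. This is a quotient $\Lambda^*\mathcal{A}=\Omega^*/\mathcal{J}$ with the induced product and $\mathbf{d}$, where $\mathcal{J}=\bigoplus_r\mathcal{J}^r$ is a graded two-sided ideal with $\mathcal{J}^0=0$, stable under $\mathbf{d}$, with each $\mathcal{J}^r$ closed in $\Omega^r$ for coefficientwise convergence (so that infinite formal sums make sense in the quotient), and such that, for $m,p\in\mathcal{L}$, in $\Lambda^1\mathcal{A}$ one has $\mathbf{b}_{m,p}\ne0$ if $p=m+v_j$ for some $j\in[n]\cup[n]'$, and $\mathbf{b}_{m,p}=0$ otherwise. The nonvanishing $\mathbf{b}_{m,p}$ are the edges of the associated graph on $\mathcal{L}$. One-forms. For $j\in[n]\cup[n]'$, $\Theta^{v_j}=\sum_{m\in\mathcal{L}}\mathbf{b}_{m,m+v_j}\in\Lambda^1\mathcal{A}$. *)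

theory Defs
  imports "HOL-Analysis.Analysis" "HOL-Algebra.QuotRing"
begin

section \<open>The universal calculus on a set of points\<close>

text \<open>A symbol of degree \<open>r\<close> is a list of \<open>r + 1\<close> points with distinct neighbours. A possibly
  infinite formal combination of symbols is its coefficient function on lists, which vanishes
  on every list that is not a symbol.\<close>

definition symbols :: "'a set \<Rightarrow> nat \<Rightarrow> 'a list set" where
  "symbols L r = {xs. length xs = Suc r \<and> set xs \<subseteq> L \<and> distinct_adj xs}"

definition forms_deg :: "'a set \<Rightarrow> nat \<Rightarrow> ('a list \<Rightarrow> complex) set" where
  "forms_deg L r = {\<omega>. \<forall>xs. \<omega> xs \<noteq> 0 \<longrightarrow> xs \<in> symbols L r}"

text \<open>Infinite combinations within each degree, but only finitely many degrees.\<close>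

definition forms :: "'a set \<Rightarrow> ('a list \<Rightarrow> complex) set" where
  "forms L = {\<omega>. \<exists>N. \<forall>xs. \<omega> xs \<noteq> 0 \<longrightarrow> (\<exists>r\<le>N. xs \<in> symbols L r)}"

definition hom_part :: "nat \<Rightarrow> ('a list \<Rightarrow> complex) \<Rightarrow> 'a list \<Rightarrow> complex" where
  "hom_part r \<omega> = (\<lambda>xs. if length xs = Suc r then \<omega> xs else 0)"

definition basis_form :: "'a list \<Rightarrow> 'a list \<Rightarrow> complex" where
  "basis_form xs = (\<lambda>ys. if ys = xs \<and> distinct_adj xs then 1 else 0)"

text \<open>Concatenation read coefficientwise: the symbol \<open>xs\<close> arises from the pairs of an initial
  and a final segment of \<open>xs\<close> that overlap in exactly one point.\<close>

definition form_mult ::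
    "('a list \<Rightarrow> complex) \<Rightarrow> ('a list \<Rightarrow> complex) \<Rightarrow> 'a list \<Rightarrow> complex" where
  "form_mult \<omega> \<eta> = (\<lambda>xs. \<Sum>i<length xs. \<omega> (take (Suc i) xs) * \<eta> (drop i xs))"

text \<open>The exterior derivative read coefficientwise: the symbol \<open>xs\<close> arises from the lists
  obtained by deleting one of its entries; see \<open>form_d_basis_form\<close> below for the insertion
  formula on basis elements.\<close>

definition form_d :: "'a set \<Rightarrow> ('a list \<Rightarrow> complex) \<Rightarrow> 'a list \<Rightarrow> complex" where
  "form_d L \<omega> = (\<lambda>xs. if set xs \<subseteq> L \<and> distinct_adj xs
     then \<Sum>s<length xs. (- 1) ^ s * \<omega> (take s xs @ drop (Suc s) xs) else 0)"

definition universal_calculus :: "'a set \<Rightarrow> ('a list \<Rightarrow> complex) ring" where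
  "universal_calculus L =
    \<lparr>carrier = forms L, monoid.mult = form_mult,
     one = (\<lambda>xs. if length xs = 1 \<and> set xs \<subseteq> L then 1 else 0),
     zero = (\<lambda>xs. 0), add = (\<lambda>\<omega> \<eta> xs. \<omega> xs + \<eta> xs)\<rparr>"

lemma form_mult_basis_form:
  assumes "xs \<noteq> []" "ys \<noteq> []"
  shows "form_mult (basis_form xs) (basis_form ys) =
    (if last xs = hd ys then \<lambda>zs. if distinct_adj xs \<and> distinct_adj ys
        then basis_form (xs @ tl ys) zs else 0 else (\<lambda>zs. 0))"
proof
  fix zs :: "'a list"
  define i where "i = length xs - 1"
  have li: "length xs = Suc i" using assms by (simp add: i_def)
  let ?P = "distinct_adj xs \<and> distinct_adj ys \<and> zs = xs @ tl ys \<and> last xs = hd ys"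
  have key: "take (Suc k) zs = xs \<and> drop k zs = ys \<longleftrightarrow> k = i \<and> zs = xs @ tl ys \<and> last xs = hd ys"
    if "k < length zs" for k
  proof
    assume a: "take (Suc k) zs = xs \<and> drop k zs = ys"
    hence "length xs = Suc k" using that by auto
    hence k: "k = i" using li by simp
    have "drop k zs = zs ! k # drop (Suc k) zs" using that by (simp add: Cons_nth_drop_Suc)
    hence "hd ys = zs ! k" "tl ys = drop (Suc k) zs" using a by (metis list.sel(1), metis list.sel(3))
    moreover have "last xs = zs ! k" using a that by (metis last_snoc take_Suc_conv_app_nth)
    moreover have "zs = xs @ drop (Suc k) zs" using a by (metis append_take_drop_id)
    ultimately show "k = i \<and> zs = xs @ tl ys \<and> last xs = hd ys" using k by simp
  next
    assume a: "k = i \<and> zs = xs @ tl ys \<and> last xs = hd ys"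
    have "xs = butlast xs @ [last xs]" using assms by simp
    hence "zs = butlast xs @ ys" using a assms
      by (metis append.assoc append_Cons append_Nil list.collapse)
    moreover have "length (butlast xs) = i" using li by simp
    ultimately have "drop i zs = ys" by simp
    moreover have "take (Suc i) zs = xs" using a li by simp
    ultimately show "take (Suc k) zs = xs \<and> drop k zs = ys" using a by simp
  qed
  have "form_mult (basis_form xs) (basis_form ys) zs =
    (\<Sum>k<length zs. if k = i then (if ?P then 1 else 0) else 0)"
    unfolding form_mult_def
  proof (rule sum.cong)
    fix k assume "k \<in> {..<length zs}"
    hence k: "take (Suc k) zs = xs \<and> drop k zs = ys \<longleftrightarrow>
        k = i \<and> zs = xs @ tl ys \<and> last xs = hd ys" by (intro key) simp
    have "basis_form xs (take (Suc k) zs) * basis_form ys (drop k zs) =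
        (if (take (Suc k) zs = xs \<and> drop k zs = ys) \<and> distinct_adj xs \<and> distinct_adj ys
         then 1 else 0)"
      by (simp add: basis_form_def)
    also have "\<dots> = (if k = i then (if ?P then 1 else 0) else 0)"
      unfolding k by (simp only: split: if_split) blast
    finally show "basis_form xs (take (Suc k) zs) * basis_form ys (drop k zs) =
        (if k = i then (if ?P then 1 else 0) else 0)" .
  qed simp
  also have "\<dots> = (if ?P then 1 else 0)"
    using li by (auto simp: sum.delta)
  finally have 1: "form_mult (basis_form xs) (basis_form ys) zs = (if ?P then 1 else 0)" .
  have 2: "distinct_adj (xs @ tl ys)"
    if "distinct_adj xs" "distinct_adj ys" "last xs = hd ys"
    using that assms
    by (cases ys; cases "tl ys") (auto simp: distinct_adj_append_iff)
  show "form_mult (basis_form xs) (basis_form ys) zs =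
    (if last xs = hd ys then \<lambda>zs. if distinct_adj xs \<and> distinct_adj ys
        then basis_form (xs @ tl ys) zs else 0 else (\<lambda>zs. 0)) zs"
    unfolding 1 using 2 by (auto simp: basis_form_def)
qed

lemma form_d_basis_form:
  assumes "xs \<in> symbols L r"
  shows "form_d L (basis_form xs) ys =
    (\<Sum>\<^sub>\<infinity>l\<in>L. \<Sum>s\<le>Suc r. (- 1) ^ s * basis_form (take s xs @ l # drop s xs) ys)"
proof -
  have xs: "length xs = Suc r" "set xs \<subseteq> L" "distinct_adj xs"
    using assms by (auto simp: symbols_def)
  let ?g = "\<lambda>l s. (- 1) ^ s * basis_form (take s xs @ l # drop s xs) ys"
  have key: "ys = take s xs @ l # drop s xs \<longleftrightarrow>
      length ys = Suc (Suc r) \<and> ys ! s = l \<and> take s ys @ drop (Suc s) ys = xs" 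
    if "s \<le> Suc r" for s l
  proof
    assume "ys = take s xs @ l # drop s xs"
    thus "length ys = Suc (Suc r) \<and> ys ! s = l \<and> take s ys @ drop (Suc s) ys = xs"
      using that xs(1) by (auto simp: nth_append)
  next
    assume a: "length ys = Suc (Suc r) \<and> ys ! s = l \<and> take s ys @ drop (Suc s) ys = xs"
    hence "take s xs = take s ys" "drop s xs = drop (Suc s) ys" using that by auto
    moreover have "ys = take s ys @ ys ! s # drop (Suc s) ys"
      using a that by (intro id_take_nth_drop) auto
    ultimately show "ys = take s xs @ l # drop s xs" using a by simp
  qed
  show ?thesis
  proof (cases "set ys \<subseteq> L \<and> distinct_adj ys \<and> length ys = Suc (Suc r)")
    case True
    have z: "?g l s = 0" if "l \<notin> set ys" "s \<le> Suc r" for l s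
      using that by (auto simp: basis_form_def)
    have "(\<Sum>\<^sub>\<infinity>l\<in>L. \<Sum>s\<le>Suc r. ?g l s) = (\<Sum>\<^sub>\<infinity>l\<in>set ys. \<Sum>s\<le>Suc r. ?g l s)"
      by (rule infsum_cong_neutral) (use True z in \<open>auto intro!: sum.neutral\<close>)
    also have "\<dots> = (\<Sum>l\<in>set ys. \<Sum>s\<le>Suc r. ?g l s)" by simp
    also have "\<dots> = (\<Sum>s\<le>Suc r. \<Sum>l\<in>set ys. ?g l s)" by (rule sum.swap)
    also have "\<dots> = (\<Sum>s\<le>Suc r. (- 1) ^ s * basis_form xs (take s ys @ drop (Suc s) ys))"
    proof (rule sum.cong)
      fix s assume "s \<in> {..Suc r}"
      hence s: "s \<le> Suc r" by simp
      have "(\<Sum>l\<in>set ys. ?g l s) = (\<Sum>l\<in>set ys. if l = ys ! s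
          then (- 1) ^ s * basis_form xs (take s ys @ drop (Suc s) ys) else 0)"
      proof (rule sum.cong)
        fix l
        have "basis_form zs ys = (if ys = zs then 1 else 0)" for zs
          using True by (auto simp: basis_form_def)
        moreover have "basis_form xs zs = (if zs = xs then 1 else 0)" for zs
          using xs by (auto simp: basis_form_def)
        ultimately show "?g l s = (if l = ys ! s
            then (- 1) ^ s * basis_form xs (take s ys @ drop (Suc s) ys) else 0)"
          using key[OF s, of l] True by (simp only: simp_thms if_cancel mult_zero_right mult_1_right split: if_split) blast
      qed simp
      also have "\<dots> = (- 1) ^ s * basis_form xs (take s ys @ drop (Suc s) ys)"
        using s True by (simp add: sum.delta)
      finally show "(\<Sum>l\<in>set ys. ?g l s) = \<dots>" .
    qed simp
    also have "\<dots> = form_d L (basis_form xs) ys"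
      using True by (simp add: form_d_def lessThan_Suc_atMost del: sum.lessThan_Suc sum.atMost_Suc)
    finally show ?thesis by simp
  next
    case False
    have l0: "form_d L (basis_form xs) ys = 0"
    proof (cases "set ys \<subseteq> L \<and> distinct_adj ys")
      case T: True
      hence "length ys \<noteq> Suc (Suc r)" using False by blast
      hence "basis_form xs (take s ys @ drop (Suc s) ys) = 0" if "s < length ys" for s
        using that xs(1) by (auto simp: basis_form_def)
      thus ?thesis by (simp add: form_d_def)
    qed (auto simp: form_d_def)
    have "?g l s = 0" if "l \<in> L" "s \<le> Suc r" for l s
    proof -
      have "ys = take s xs @ l # drop s xs \<and> distinct_adj ys \<longrightarrow> set ys \<subseteq> L \<and> length ys = Suc (Suc r)"
      proof
        assume a: "ys = take s xs @ l # drop s xs \<and> distinct_adj ys"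
        hence "set ys = set (take s xs) \<union> insert l (set (drop s xs))" by (metis list.set(2) set_append)
        thus "set ys \<subseteq> L \<and> length ys = Suc (Suc r)"
          using a that xs set_take_subset[of s xs] set_drop_subset[of s xs] key[OF that(2), of l] by blast
      qed
      thus ?thesis using False by (auto simp: basis_form_def)
    qed
    hence "(\<Sum>\<^sub>\<infinity>l\<in>L. \<Sum>s\<le>Suc r. ?g l s) = (\<Sum>\<^sub>\<infinity>l\<in>L. 0)"
      by (intro infsum_cong sum.neutral) auto
    thus ?thesis using l0 by simp
  qed
qed

lemma formsI: "(\<And>xs. \<omega> xs \<noteq> 0 \<Longrightarrow> \<exists>r\<le>N. xs \<in> symbols L r) \<Longrightarrow> \<omega> \<in> forms L"
  unfolding forms_def mem_Collect_eq by (rule exI[of _ N]) simp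

lemma form_mult_closed:
  assumes "\<omega> \<in> forms L" "\<eta> \<in> forms L"
  shows "form_mult \<omega> \<eta> \<in> forms L"
proof -
  from assms(1) obtain M where M: "\<forall>xs. \<omega> xs \<noteq> 0 \<longrightarrow> (\<exists>r\<le>M. xs \<in> symbols L r)"
    unfolding forms_def mem_Collect_eq by (rule exE)
  from assms(2) obtain N where N: "\<forall>xs. \<eta> xs \<noteq> 0 \<longrightarrow> (\<exists>r\<le>N. xs \<in> symbols L r)"
    unfolding forms_def mem_Collect_eq by (rule exE)
  have "\<exists>r\<le>M + N. xs \<in> symbols L r" if "form_mult \<omega> \<eta> xs \<noteq> 0" for xs
  proof -
    have "\<exists>i\<in>{..<length xs}. \<omega> (take (Suc i) xs) * \<eta> (drop i xs) \<noteq> 0"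
    proof (rule ccontr)
      assume "\<not> ?thesis"
      hence "form_mult \<omega> \<eta> xs = 0" unfolding form_mult_def by (intro sum.neutral) metis
      thus False using that by simp
    qed
    then obtain i where i: "i < length xs" "\<omega> (take (Suc i) xs) * \<eta> (drop i xs) \<noteq> 0"
      unfolding bex_simps lessThan_iff by auto
    obtain r s where r: "r \<le> M" "take (Suc i) xs \<in> symbols L r"
      and s: "s \<le> N" "drop i xs \<in> symbols L s"
      using M[rule_format, of "take (Suc i) xs"] N[rule_format, of "drop i xs"] i(2)
      unfolding mult_eq_0_iff by blast
    have [simp]: "r = i" using r i by (simp add: symbols_def)
    have len: "length xs = Suc (i + s)" using s(2) i(1) unfolding symbols_def mem_Collect_eq length_drop by linarith
    have eq: "xs = take i xs @ drop i xs" by simp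
    have eq2: "take (Suc i) xs = take i xs @ [xs ! i]" using i by (simp add: take_Suc_conv_app_nth)
    have hd: "hd (drop i xs) = xs ! i" using i by (simp add: hd_drop_conv_nth)
    have sub: "set xs \<subseteq> L"
      using r s by (subst eq, unfold set_append) (auto simp: symbols_def eq2)
    have "distinct_adj (take i xs @ drop i xs)"
      using r s i unfolding symbols_def eq2 mem_Collect_eq distinct_adj_append_iff
      by (simp add: hd)
    hence "distinct_adj xs" by simp
    thus ?thesis using len sub r s by (intro exI[of _ "i + s"]) (auto simp: symbols_def)
  qed
  thus ?thesis by (rule formsI)
qed

lemma form_mult_assoc: "form_mult (form_mult \<omega> \<eta>) \<zeta> = form_mult \<omega> (form_mult \<eta> \<zeta>)"
proof
  fix xs :: "'a list"
  let ?n = "length xs"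
  let ?t = "\<lambda>j i. \<omega> (take (Suc j) xs) * (\<eta> (drop j (take (Suc i) xs)) * \<zeta> (drop i xs))"
  have "form_mult (form_mult \<omega> \<eta>) \<zeta> xs = (\<Sum>i<?n. \<Sum>j\<le>i. ?t j i)"
    unfolding form_mult_def
    by (intro sum.cong) (auto simp: sum_distrib_right min_def lessThan_Suc_atMost mult.assoc
      simp del: sum.lessThan_Suc sum.atMost_Suc drop_take intro!: sum.cong)
  also have "\<dots> = (\<Sum>(i, j)\<in>Sigma {..<?n} (\<lambda>i. {..i}). ?t j i)"
    by (rule sum.Sigma) auto
  also have "\<dots> = (\<Sum>(j, k)\<in>Sigma {..<?n} (\<lambda>j. {..<?n - j}). ?t j (j + k))"
    by (rule sum.reindex_bij_witness[of _ "\<lambda>(j, k). (j + k, j)" "\<lambda>(i, j). (j, i - j)"]) auto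
  also have "\<dots> = (\<Sum>j<?n. \<Sum>k<?n - j. ?t j (j + k))"
    by (rule sum.Sigma[symmetric]) auto
  also have "\<dots> = form_mult \<omega> (form_mult \<eta> \<zeta>) xs"
    unfolding form_mult_def
    by (intro sum.cong) (auto simp: sum_distrib_left drop_take Suc_diff_le add.commute
      intro!: sum.cong)
  finally show "form_mult (form_mult \<omega> \<eta>) \<zeta> xs = form_mult \<omega> (form_mult \<eta> \<zeta>) xs" .
qed

lemma ring_universal_calculus: "ring (universal_calculus L)"
proof -
  have add: "(\<lambda>xs. \<omega> xs + \<eta> xs) \<in> forms L" if "\<omega> \<in> forms L" "\<eta> \<in> forms L" for \<omega> \<eta> :: "'a list \<Rightarrow> complex"
  proof -
    from that(1) obtain M where M: "\<forall>xs. \<omega> xs \<noteq> 0 \<longrightarrow> (\<exists>r\<le>M. xs \<in> symbols L r)"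
      unfolding forms_def mem_Collect_eq by (rule exE)
    from that(2) obtain N where N: "\<forall>xs. \<eta> xs \<noteq> 0 \<longrightarrow> (\<exists>r\<le>N. xs \<in> symbols L r)"
      unfolding forms_def mem_Collect_eq by (rule exE)
    have "\<exists>r\<le>max M N. xs \<in> symbols L r" if "\<omega> xs + \<eta> xs \<noteq> 0" for xs
    proof -
      have "\<omega> xs \<noteq> 0 \<or> \<eta> xs \<noteq> 0" using that by auto
      thus ?thesis using M[rule_format, of xs] N[rule_format, of xs]
        by (metis max.coboundedI1 max.coboundedI2)
    qed
    thus ?thesis by (rule formsI)
  qed
  have uminus: "\<exists>\<eta>\<in>forms L. (\<lambda>xs. \<eta> xs + \<omega> xs) = (\<lambda>xs. 0)" if "\<omega> \<in> forms L" for \<omega> :: "'a list \<Rightarrow> complex"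
    by (rule bexI[of _ "\<lambda>xs. - \<omega> xs"]) (use that in \<open>simp_all add: forms_def\<close>)
  have zero: "(\<lambda>xs. 0) \<in> forms L"
    by (simp add: forms_def)
  have abel: "abelian_group (universal_calculus L)"
    by (rule abelian_groupI)
      (use add uminus zero in \<open>simp_all add: universal_calculus_def add_ac\<close>)
  let ?one = "\<lambda>xs. if length xs = 1 \<and> set xs \<subseteq> L then 1 else (0::complex)"
  have one: "?one \<in> forms L"
    by (rule formsI[of _ 0]) (auto simp: symbols_def length_Suc_conv split: if_splits)
  have supp: "xs \<noteq> [] \<and> set xs \<subseteq> L" if "\<omega> \<in> forms L" "\<omega> xs \<noteq> 0" for \<omega> xs
  proof -
    from that(1) obtain N where "\<forall>xs. \<omega> xs \<noteq> 0 \<longrightarrow> (\<exists>r\<le>N. xs \<in> symbols L r)"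
      unfolding forms_def mem_Collect_eq by (rule exE)
    with that(2) obtain r where "xs \<in> symbols L r" by metis
    thus ?thesis by (auto simp: symbols_def)
  qed
  have l1: "form_mult ?one \<omega> = \<omega>" if w: "\<omega> \<in> forms L" for \<omega>
  proof
    fix xs
    have "form_mult ?one \<omega> xs = (\<Sum>i<length xs. if i = 0 then \<omega> xs else 0)"
      unfolding form_mult_def
    proof (rule sum.cong)
      fix i assume "i \<in> {..<length xs}"
      thus "?one (take (Suc i) xs) * \<omega> (drop i xs) = (if i = 0 then \<omega> xs else 0)"
        using supp[OF w, of xs] by (cases xs) auto
    qed simp
    also have "\<dots> = \<omega> xs" using supp[OF w, of xs] by (cases xs) (auto simp: sum.delta)
    finally show "form_mult ?one \<omega> xs = \<omega> xs" .
  qed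
  have r1: "form_mult \<omega> ?one = \<omega>" if w: "\<omega> \<in> forms L" for \<omega>
  proof
    fix xs
    have "form_mult \<omega> ?one xs = (\<Sum>i<length xs. if i = length xs - 1 then \<omega> xs else 0)"
      unfolding form_mult_def
    proof (rule sum.cong)
      fix i assume i: "i \<in> {..<length xs}"
      show "\<omega> (take (Suc i) xs) * ?one (drop i xs) = (if i = length xs - 1 then \<omega> xs else 0)"
        using supp[OF w, of xs] i set_drop_subset[of i xs] by auto
    qed simp
    also have "\<dots> = \<omega> xs" using supp[OF w, of xs] by (cases xs) (auto simp: sum.delta)
    finally show "form_mult \<omega> ?one xs = \<omega> xs" .
  qed
  have mon: "monoid (universal_calculus L)"
    by (rule monoidI)
      (use one l1 r1 in \<open>simp_all add: universal_calculus_def form_mult_closed form_mult_assoc\<close>)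
  show ?thesis
    by (rule ringI[OF abel mon])
      (simp_all add: universal_calculus_def form_mult_def algebra_simps sum.distrib)
qed

section \<open>Symmetric lattice reductions\<close>

definition lattice_pts :: "('n::finite \<Rightarrow> real ^ 'n) \<Rightarrow> (real ^ 'n) set" where
  "lattice_pts v = {\<Sum>i\<in>UNIV. of_int (c i) *\<^sub>R v i |c :: 'n \<Rightarrow> int. True}"

text \<open>The index type \<open>'n + 'n\<close> is the disjoint union of \<open>[n]\<close> and its primed copy.\<close>

definition step :: "('n::finite \<Rightarrow> real ^ 'n) \<Rightarrow> 'n + 'n \<Rightarrow> real ^ 'n" where
  "step v = case_sum v (\<lambda>j. - v j)"

abbreviation lattice_calculus ::
    "('n::finite \<Rightarrow> real ^ 'n) \<Rightarrow> ((real ^ 'n) list \<Rightarrow> complex) ring" where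
  "lattice_calculus v \<equiv> universal_calculus (lattice_pts v)"

definition reduction ::
    "('n::finite \<Rightarrow> real ^ 'n) \<Rightarrow> ((real ^ 'n) list \<Rightarrow> complex) set \<Rightarrow>
      ((real ^ 'n) list \<Rightarrow> complex) set ring" where
  "reduction v J = lattice_calculus v Quot J"

definition reduce ::
    "('n::finite \<Rightarrow> real ^ 'n) \<Rightarrow> ((real ^ 'n) list \<Rightarrow> complex) set \<Rightarrow>
      ((real ^ 'n) list \<Rightarrow> complex) \<Rightarrow> ((real ^ 'n) list \<Rightarrow> complex) set" where
  "reduce v J \<omega> = J +>\<^bsub>lattice_calculus v\<^esub> \<omega>"

text \<open>A ring ideal of the universal calculus is automatically a complex subspace, because the
  constant functions lie in degree 0. Functions into \<^typ>\<open>complex\<close> carry the product topology,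
  which is coefficientwise convergence. The assumption \<open>d_stable\<close> is what makes the
  exterior derivative descend to the quotient.\<close>

locale symmetric_lattice_reduction =
  fixes v :: "'n::finite \<Rightarrow> real ^ 'n"
    and J :: "((real ^ 'n) list \<Rightarrow> complex) set"
  assumes inj_v: "inj v"
    and independent_v: "independent (range v)"
    and ideal_J: "ideal J (lattice_calculus v)"
    and graded: "\<And>\<omega> r. \<omega> \<in> J \<Longrightarrow> hom_part r \<omega> \<in> J"
    and degree_0: "J \<inter> forms_deg (lattice_pts v) 0 = {\<lambda>xs. 0}"
    and d_stable: "\<And>\<omega>. \<omega> \<in> J \<Longrightarrow> form_d (lattice_pts v) \<omega> \<in> J"
    and closed_deg: "\<And>r. closedin (top_of_set (forms_deg (lattice_pts v) r))
                           (J \<inter> forms_deg (lattice_pts v) r)"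
    and edges: "\<And>m p. m \<in> lattice_pts v \<Longrightarrow> p \<in> lattice_pts v \<Longrightarrow>
      reduce v J (basis_form [m, p]) \<noteq> \<zero>\<^bsub>reduction v J\<^esub> \<longleftrightarrow> (\<exists>j. p = m + step v j)"

text \<open>The infinite sum over the lattice is taken coefficientwise; each coefficient has at most
  one nonzero summand.\<close>

definition Theta ::
    "('n::finite \<Rightarrow> real ^ 'n) \<Rightarrow> ((real ^ 'n) list \<Rightarrow> complex) set \<Rightarrow> 'n + 'n \<Rightarrow>
      ((real ^ 'n) list \<Rightarrow> complex) set" where
  "Theta v J j =
    reduce v J (\<lambda>xs. \<Sum>\<^sub>\<infinity>m\<in>lattice_pts v. basis_form [m, m + step v j] xs)"

definition anticommutator :: "('a, 'b) ring_scheme \<Rightarrow> 'a \<Rightarrow> 'a \<Rightarrow> 'a" where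
  "anticommutator R x y = x \<otimes>\<^bsub>R\<^esub> y \<oplus>\<^bsub>R\<^esub> y \<otimes>\<^bsub>R\<^esub> x"

end

theory Submission
  imports Defs
begin

text \<open>For \<open>q = m + v\<^sub>j + v\<^sub>k \<noteq> m\<close>, independence shows that \<open>(m, q)\<close> is not an edge, so \<open>b\<^sub>m\<^sub>q\<close> and
  hence \<open>b\<^sub>m (d b\<^sub>m\<^sub>q) b\<^sub>q = - (\<Sum>l. b\<^sub>m\<^sub>l\<^sub>q)\<close> lie in the ideal. Again by independence, the only
  paths of two edges from \<open>m\<close> to \<open>q\<close> run through \<open>m + v\<^sub>j\<close> and \<open>m + v\<^sub>k\<close>, which leaves
  the relation that these two paths cancel. If \<open>v\<^sub>j + v\<^sub>k = 0\<close>, the paths vanish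
  individually. Summing over \<open>m\<close>, which is possible because the ideal is closed under
  coefficientwise limits, gives the anticommutator.\<close>

section \<open>Coefficientwise convergence and formal sums of symbols\<close>

lemma tendsto_fun_coordinatewise:
  fixes f :: "'i \<Rightarrow> 'a \<Rightarrow> 'b::topological_space"
  assumes "\<And>x. ((\<lambda>i. f i x) \<longlongrightarrow> l x) F"
  shows "(f \<longlongrightarrow> l) F"
  using assms limitin_componentwise[of "\<lambda>_. euclidean" UNIV f l F]
  by (simp add: euclidean_product_topology)

text \<open>A formal infinite sum of symbols, each counted once, given directly by its coefficients.
  Lists with equal neighbours contribute zero, as in \<open>basis_form\<close>.\<close>

definition symbol_sum :: "'a list set \<Rightarrow> 'a list \<Rightarrow> complex" where
  "symbol_sum S = (\<lambda>xs. if xs \<in> S \<and> distinct_adj xs then 1 else 0)"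

text \<open>By injectivity each list is hit by at most one index, so every coefficient is a sum with
  at most one nonzero term.\<close>

lemma has_sum_basis_form:
  assumes "inj_on f A"
  shows "((\<lambda>i. basis_form (f i) xs) has_sum symbol_sum (f ` A) xs) A"
proof (cases "xs \<in> f ` A")
  case True
  then obtain i where i: "i \<in> A" "xs = f i" by blast
  have "((\<lambda>i. basis_form (f i) xs) has_sum symbol_sum (f ` A) xs) A \<longleftrightarrow>
      ((\<lambda>i. basis_form (f i) xs) has_sum symbol_sum (f ` A) xs) {i}"
    by (rule has_sum_cong_neutral) (use i inj_onD[OF assms] in \<open>auto simp: basis_form_def\<close>)
  moreover have "symbol_sum (f ` A) xs = (\<Sum>i\<in>{i}. basis_form (f i) xs)"
    using i by (auto simp: symbol_sum_def basis_form_def)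
  ultimately show ?thesis
    by (metis (no_types, lifting) finite.emptyI finite.insertI has_sum_finiteI)
next
  case False
  then have "((\<lambda>i. basis_form (f i) xs) has_sum 0) A"
    by (intro has_sum_0) (auto simp: basis_form_def)
  with False show ?thesis
    by (simp add: symbol_sum_def)
qed

lemma basis_form_in_forms_deg:
  "set xs \<subseteq> L \<Longrightarrow> length xs = Suc r \<Longrightarrow> basis_form xs \<in> forms_deg L r"
  by (auto simp: forms_deg_def symbols_def basis_form_def)

lemma symbol_sum_in_forms_deg:
  "(\<And>xs. xs \<in> S \<Longrightarrow> set xs \<subseteq> L \<and> length xs = Suc r) \<Longrightarrow> symbol_sum S \<in> forms_deg L r"
  by (auto simp: forms_deg_def symbols_def symbol_sum_def)

lemma forms_deg_add:
  "\<omega> \<in> forms_deg L r \<Longrightarrow> \<eta> \<in> forms_deg L r \<Longrightarrow> (\<lambda>xs. \<omega> xs + \<eta> xs) \<in> forms_deg L r"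
  unfolding forms_deg_def mem_Collect_eq by (metis add_0)

lemma forms_deg_subset_forms: "forms_deg L r \<subseteq> forms L"
  by (auto simp: forms_deg_def forms_def)

section \<open>Products and derivatives in the universal calculus\<close>

text \<open>A point function lives on a one-point list, so only the split at index 0 survives: left
  multiplication projects onto the symbols starting at \<open>m\<close>.\<close>

lemma form_mult_point_left:
  assumes "\<omega> [] = 0"
  shows "form_mult (basis_form [m]) \<omega> xs = (if xs \<noteq> [] \<and> hd xs = m then \<omega> xs else 0)"
proof -
  have "form_mult (basis_form [m]) \<omega> xs =
      (\<Sum>i<length xs. if i = 0 then (if hd xs = m then \<omega> xs else 0) else 0)"
    unfolding form_mult_def
    by (rule sum.cong) (cases xs; auto simp: basis_form_def)+
  then show ?thesis
    using assms by (auto simp: sum.delta)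
qed

lemma form_mult_point_right:
  assumes "\<omega> [] = 0"
  shows "form_mult \<omega> (basis_form [q]) xs = (if xs \<noteq> [] \<and> last xs = q then \<omega> xs else 0)"
proof -
  have "form_mult \<omega> (basis_form [q]) xs =
      (\<Sum>i<length xs. if i = length xs - 1 then (if last xs = q then \<omega> xs else 0) else 0)"
    unfolding form_mult_def
  proof (rule sum.cong)
    fix i assume i: "i \<in> {..<length xs}"
    then have "xs \<noteq> []" "length xs \<le> Suc i \<longleftrightarrow> i = length xs - 1"
      by auto
    moreover have "drop i xs = xs ! i # drop (Suc i) xs"
      using i by (simp add: Cons_nth_drop_Suc)
    \<comment> \<open>Here a one-point final segment forces the split at the last index.\<close>
    ultimately have "drop i xs = [q] \<longleftrightarrow> i = length xs - 1 \<and> last xs = q"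
      by (auto simp: last_conv_nth)
    then show "\<omega> (take (Suc i) xs) * basis_form [q] (drop i xs) =
        (if i = length xs - 1 then (if last xs = q then \<omega> xs else 0) else 0)"
      using i by (auto simp: basis_form_def)
  qed simp
  then show ?thesis
    using assms by (auto simp: sum.delta)
qed

text \<open>The derivative inserts a point before, between or after \<open>m\<close> and
  \<open>q\<close>. Outer insertions surviving both projections would repeat \<open>m\<close> or
  \<open>q\<close> and hence vanish; the middle insertion carries the sign -1.\<close>

lemma form_d_edge_sandwich:
  assumes "m \<noteq> q" "m \<in> L" "q \<in> L"
  shows "form_mult (basis_form [m]) (form_mult (form_d L (basis_form [m, q])) (basis_form [q]))
    = (\<lambda>xs. - symbol_sum ((\<lambda>l. [m, l, q]) ` L) xs)"
proof
  fix xs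
  let ?d = "form_d L (basis_form [m, q])"
  have nil: "?d [] = 0" "form_mult ?d (basis_form [q]) [] = 0"
    by (simp_all add: form_d_def form_mult_def)
  have "form_mult (basis_form [m]) (form_mult ?d (basis_form [q])) xs =
      (if xs \<noteq> [] \<and> hd xs = m \<and> last xs = q then ?d xs else 0)"
    by (simp add: form_mult_point_left form_mult_point_right nil)
  also have "\<dots> = - symbol_sum ((\<lambda>l. [m, l, q]) ` L) xs"
  proof (cases "length xs = 3")
    case True
    then obtain a b c where "xs = [a, b, c]"
      by (auto simp: numeral_3_eq_3 length_Suc_conv)
    then show ?thesis
      using assms by (auto simp: form_d_def symbol_sum_def basis_form_def lessThan_Suc)
  next
    case False
    then have "basis_form [m, q] (take s xs @ drop (Suc s) xs) = 0" if "s < length xs" for s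
      using that by (auto simp: basis_form_def dest!: arg_cong[where f = length])
    then have "?d xs = 0"
      by (simp add: form_d_def)
    moreover have "symbol_sum ((\<lambda>l. [m, l, q]) ` L) xs = 0"
      using False by (auto simp: symbol_sum_def)
    ultimately show ?thesis by simp
  qed
  finally show "form_mult (basis_form [m]) (form_mult ?d (basis_form [q])) xs =
      - symbol_sum ((\<lambda>l. [m, l, q]) ` L) xs" .
qed

text \<open>Concatenation forces the second edge to start at \<open>m + a\<close>; the closure
  hypothesis ensures that this edge occurs in the second sum.\<close>

lemma form_mult_edge_sums:
  assumes "\<And>m. m \<in> L \<Longrightarrow> m + a \<in> L"
  shows "form_mult (symbol_sum ((\<lambda>m. [m, m + a]) ` L)) (symbol_sum ((\<lambda>m. [m, m + b]) ` L))
    = symbol_sum ((\<lambda>m. [m, m + a, m + a + b]) ` L)"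
proof
  fix xs
  let ?T = "\<lambda>a. symbol_sum ((\<lambda>m. [m, m + a]) ` L)"
  have "form_mult (?T a) (?T b) xs =
      (\<Sum>i<length xs. if i = 1 then ?T a (take 2 xs) * ?T b (drop 1 xs) else 0)"
    unfolding form_mult_def
  proof (rule sum.cong)
    fix i assume i: "i \<in> {..<length xs}"
    \<comment> \<open>The left factor lives on two-point lists, while this initial segment has
      length \<open>Suc i\<close>.\<close>
    have "?T a (take (Suc i) xs) = 0" if "i \<noteq> 1"
      using i that by (auto simp: symbol_sum_def dest!: arg_cong[where f = length])
    then show "?T a (take (Suc i) xs) * ?T b (drop i xs)
        = (if i = 1 then ?T a (take 2 xs) * ?T b (drop 1 xs) else 0)"
      by (simp add: numeral_2_eq_2)
  qed simp
  also have "\<dots> = (if 1 < length xs then ?T a (take 2 xs) * ?T b (drop 1 xs) else 0)"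
    by (simp add: sum.delta)
  also have "\<dots> = symbol_sum ((\<lambda>m. [m, m + a, m + a + b]) ` L) xs"
  proof (cases "length xs = 3")
    case True
    then obtain x y z where "xs = [x, y, z]"
      by (auto simp: numeral_3_eq_3 length_Suc_conv)
    then show ?thesis
      using assms by (auto simp: symbol_sum_def)
  next
    case False
    then have "?T b (drop 1 xs) = 0" if "1 < length xs"
      using that by (auto simp: symbol_sum_def dest!: arg_cong[where f = length])
    moreover have "symbol_sum ((\<lambda>m. [m, m + a, m + a + b]) ` L) xs = 0"
      using False by (auto simp: symbol_sum_def)
    ultimately show ?thesis by simp
  qed
  finally show "form_mult (?T a) (?T b) xs = symbol_sum ((\<lambda>m. [m, m + a, m + a + b]) ` L) xs" .
qed

section \<open>Steps between lattice points\<close>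

lemma step_in_lattice_pts:
  assumes "m \<in> lattice_pts v"
  shows "m + step v j \<in> lattice_pts v"
proof -
  obtain c where c: "m = (\<Sum>i\<in>UNIV. of_int (c i) *\<^sub>R v i)"
    using assms by (auto simp: lattice_pts_def)
  \<comment> \<open>The index and the sign of the step, which treats both halves of the index type
    at once.\<close>
  define e where "e = case_sum (\<lambda>k. (k, 1 :: int)) (\<lambda>k. (k, - 1)) j"
  have "step v j = of_int (snd e) *\<^sub>R v (fst e)"
    by (auto simp: e_def step_def split: sum.split)
  also have "\<dots> = (\<Sum>i\<in>UNIV. of_int (if i = fst e then snd e else 0) *\<^sub>R v i)"
    by (simp add: if_distrib if_distribR cong: if_cong)
  finally have "m + step v j = (\<Sum>i\<in>UNIV. of_int (c i + (if i = fst e then snd e else 0)) *\<^sub>R v i)"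
    by (simp add: c scaleR_add_left sum.distrib)
  then show ?thesis
    unfolding lattice_pts_def
    by (intro CollectI exI[of _ "\<lambda>i. c i + (if i = fst e then snd e else 0)"]) simp
qed

context symmetric_lattice_reduction
begin

section \<open>Closure properties of the ideal\<close>

abbreviation L where "L \<equiv> lattice_pts v"

lemma ideal_subset_forms: "\<omega> \<in> J \<Longrightarrow> \<omega> \<in> forms L"
  using ideal.Icarr[OF ideal_J] by (simp add: universal_calculus_def)

lemma ideal_zero: "(\<lambda>xs. 0) \<in> J"
  using degree_0 by blast

lemma ideal_add: "\<omega> \<in> J \<Longrightarrow> \<eta> \<in> J \<Longrightarrow> (\<lambda>xs. \<omega> xs + \<eta> xs) \<in> J"
  using additive_subgroup.a_closed[OF ideal.axioms(1)[OF ideal_J]]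
  by (simp add: universal_calculus_def)

lemma ideal_mult_left: "\<omega> \<in> J \<Longrightarrow> \<eta> \<in> forms L \<Longrightarrow> form_mult \<eta> \<omega> \<in> J"
  using ideal.I_l_closed[OF ideal_J] by (simp add: universal_calculus_def)

lemma ideal_mult_right: "\<omega> \<in> J \<Longrightarrow> \<eta> \<in> forms L \<Longrightarrow> form_mult \<omega> \<eta> \<in> J"
  using ideal.I_r_closed[OF ideal_J] by (simp add: universal_calculus_def)

text \<open>A scalar acts as left multiplication by the constant function \<open>c\<close> of degree
  0.\<close>

lemma ideal_scale:
  assumes "\<omega> \<in> J"
  shows "(\<lambda>xs. c * \<omega> xs) \<in> J"
proof -
  interpret U: ring "lattice_calculus v"
    by (rule ring_universal_calculus)
  let ?one = "\<lambda>xs. if length xs = 1 \<and> set xs \<subseteq> L then 1 else (0 :: complex)"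
  have "(\<lambda>xs. c * \<omega> xs) = form_mult (\<lambda>xs. c * ?one xs) \<omega>"
  proof
    fix xs
    have "form_mult ?one \<omega> = \<omega>"
      using U.l_one[of \<omega>] ideal_subset_forms[OF assms] by (simp add: universal_calculus_def)
    then have "c * \<omega> xs = c * form_mult ?one \<omega> xs" by simp
    then show "c * \<omega> xs = form_mult (\<lambda>xs. c * ?one xs) \<omega> xs"
      unfolding form_mult_def by (simp add: sum_distrib_left mult.assoc)
  qed
  moreover have "(\<lambda>xs. c * ?one xs) \<in> forms L"
    by (rule formsI[of _ 0]) (auto simp: symbols_def length_Suc_conv split: if_splits)
  ultimately show ?thesis
    using ideal_mult_left[OF assms] by simp
qed

lemma ideal_sum:
  "finite F \<Longrightarrow> (\<And>i. i \<in> F \<Longrightarrow> g i \<in> J) \<Longrightarrow> (\<lambda>xs. \<Sum>i\<in>F. g i xs) \<in> J"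
  by (induction F rule: finite_induct) (simp_all add: ideal_zero ideal_add)

text \<open>Finite partial sums lie in the ideal and converge coefficientwise. All terms share one
  degree because closedness is available degree by degree.\<close>

lemma ideal_infinite_sum:
  assumes "\<And>i. i \<in> A \<Longrightarrow> g i \<in> J" "\<And>i. i \<in> A \<Longrightarrow> g i \<in> forms_deg L r"
    and sum: "\<And>xs. ((\<lambda>i. g i xs) has_sum \<omega> xs) A"
  shows "\<omega> \<in> J"
proof -
  \<comment> \<open>Relative closedness is traded for a closed set \<open>T\<close> of the whole
    function space; that the limit has degree \<open>r\<close> is shown separately.\<close>
  obtain T where T: "closed T" "J \<inter> forms_deg L r = forms_deg L r \<inter> T"
    using closed_deg[of r] by (auto simp: closedin_closed)
  have "((\<lambda>F xs. \<Sum>i\<in>F. g i xs) \<longlongrightarrow> \<omega>) (finite_subsets_at_top A)"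
    using sum by (intro tendsto_fun_coordinatewise) (simp add: has_sum_def)
  moreover have "(\<lambda>xs. \<Sum>i\<in>F. g i xs) \<in> forms_deg L r" if "F \<subseteq> A" for F
    unfolding forms_deg_def
  proof (intro CollectI allI impI)
    fix xs assume "(\<Sum>i\<in>F. g i xs) \<noteq> 0"
    then obtain i where "i \<in> F" "g i xs \<noteq> 0"
      by (meson sum.neutral)
    then show "xs \<in> symbols L r"
      using assms(2) that by (auto simp: forms_deg_def)
  qed
  then have "(\<lambda>xs. \<Sum>i\<in>F. g i xs) \<in> T" if "finite F" "F \<subseteq> A" for F
    using T(2) ideal_sum[of F g] assms(1) that by blast
  then have "\<forall>\<^sub>F F in finite_subsets_at_top A. (\<lambda>xs. \<Sum>i\<in>F. g i xs) \<in> T"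
    by (intro eventually_finite_subsets_at_top_weakI)
  ultimately have "\<omega> \<in> T"
    using T(1) by (intro Lim_in_closed_set[of T _ "finite_subsets_at_top A"]) auto
  moreover have "\<omega> \<in> forms_deg L r"
    unfolding forms_deg_def
  proof (intro CollectI allI impI)
    fix xs assume "\<omega> xs \<noteq> 0"
    then have "\<exists>i\<in>A. g i xs \<noteq> 0"
      using sum[of xs] has_sum_0 has_sum_unique by (metis (no_types, lifting))
    then show "xs \<in> symbols L r"
      using assms(2) by (auto simp: forms_deg_def)
  qed
  ultimately show ?thesis using T(2) by blast
qed

section \<open>Passage between the quotient and representatives\<close>

text \<open>The zero of the quotient is the coset \<open>J\<close> itself. This turns both the edge
  condition and the goal into membership in \<open>J\<close>.\<close>

lemma reduce_eq_zero_iff: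
  assumes "\<omega> \<in> forms L"
  shows "reduce v J \<omega> = \<zero>\<^bsub>reduction v J\<^esub> \<longleftrightarrow> \<omega> \<in> J"
proof -
  interpret ideal J "lattice_calculus v" by (rule ideal_J)
  have "\<omega> \<in> carrier (lattice_calculus v)"
    using assms by (simp add: universal_calculus_def)
  then show ?thesis
    using a_rcos_const[of \<omega>] a_rcos_self[of \<omega>]
    by (auto simp: reduce_def reduction_def FactRing_def)
qed

text \<open>The quotient map is a ring homomorphism, so the computation can be made on
  representatives.\<close>

lemma anticommutator_reduce:
  assumes "\<omega> \<in> forms L" "\<eta> \<in> forms L"
  shows "anticommutator (reduction v J) (reduce v J \<omega>) (reduce v J \<eta>) =
    reduce v J (\<lambda>xs. form_mult \<omega> \<eta> xs + form_mult \<eta> \<omega> xs)"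
proof -
  interpret ideal J "lattice_calculus v" by (rule ideal_J)
  interpret h: ring_hom_ring "lattice_calculus v" "reduction v J" "reduce v J"
    using rcos_ring_hom_ring by (simp add: reduce_def[abs_def] reduction_def)
  have c: "\<omega> \<in> carrier (lattice_calculus v)" "\<eta> \<in> carrier (lattice_calculus v)"
    using assms by (simp_all add: universal_calculus_def)
  then have "anticommutator (reduction v J) (reduce v J \<omega>) (reduce v J \<eta>) =
      reduce v J (anticommutator (lattice_calculus v) \<omega> \<eta>)"
    by (simp add: anticommutator_def)
  then show ?thesis
    by (simp add: anticommutator_def universal_calculus_def)
qed

lemma basis_form_in_forms: "xs \<noteq> [] \<Longrightarrow> set xs \<subseteq> L \<Longrightarrow> basis_form xs \<in> forms L"
  by (rule subsetD[OF forms_deg_subset_forms[of L "length xs - 1"]], rule basis_form_in_forms_deg) simp_all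

lemma edge_in_ideal_iff:
  assumes "m \<in> L" "p \<in> L"
  shows "basis_form [m, p] \<in> J \<longleftrightarrow> (\<nexists>j. p = m + step v j)"
proof -
  have "basis_form [m, p] \<in> forms L"
    using assms by (intro basis_form_in_forms) auto
  then show ?thesis
    using edges[OF assms] reduce_eq_zero_iff by metis
qed

text \<open>A path of two edges is the product of its edges, and the ideal is two-sided.\<close>

lemma path_in_ideal:
  assumes "m \<in> L" "l \<in> L" "q \<in> L" "basis_form [m, l] \<in> J \<or> basis_form [l, q] \<in> J"
  shows "basis_form [m, l, q] \<in> J"
proof -
  have eq: "basis_form [m, l, q] = form_mult (basis_form [m, l]) (basis_form [l, q])"
    by (rule ext, simp add: form_mult_basis_form, simp add: basis_form_def)
  show ?thesis
    unfolding eq using assms(4)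
  proof
    assume "basis_form [m, l] \<in> J"
    then show "form_mult (basis_form [m, l]) (basis_form [l, q]) \<in> J"
      using assms by (intro ideal_mult_right basis_form_in_forms) auto
  next
    assume "basis_form [l, q] \<in> J"
    then show "form_mult (basis_form [m, l]) (basis_form [l, q]) \<in> J"
      using assms by (intro ideal_mult_left basis_form_in_forms) auto
  qed
qed

section \<open>Consequences of linear independence\<close>

text \<open>Independence lets the assignment of standard basis vectors to the \<open>v i\<close>
  extend linearly; injectivity of \<open>v\<close> makes the index of each vector
  unambiguous.\<close>

lemma coordinates:
  obtains f :: "real ^ 'n \<Rightarrow> real ^ 'n" where "linear f"
    "\<And>i. f (v i) = axis i 1"
proof -
  obtain f :: "real ^ 'n \<Rightarrow> real ^ 'n" where f: "linear f" "\<forall>x\<in>range v. f x = axis (inv_into UNIV v x) 1"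
    using linear_independent_extend[OF independent_v, of "\<lambda>x. axis (inv_into UNIV v x) 1"] by blast
  show thesis
    by (rule that[of f]) (use f inj_v in auto)
qed

text \<open>Comparing coordinates recovers both steps from a nonzero sum; two opposite steps would
  cancel and leave no trace of their index.\<close>

lemma step_add_step_eqD:
  assumes eq: "step v a + step v b = step v j + step v k"
    and nz: "step v j + step v k \<noteq> 0"
  shows "a = j \<or> a = k"
proof -
  obtain f :: "real ^ 'n \<Rightarrow> real ^ 'n" where f: "linear f" "\<And>i. f (v i) = axis i 1"
    using coordinates by blast
  interpret linear f by (rule f(1))
  let ?e = "case_sum (\<lambda>i. axis i (1::real)) (\<lambda>i. - axis i 1)"
  have fs: "f (step v x) = ?e x" for x
    by (auto simp: step_def f(2) neg split: sum.split)
  have e: "?e a $ i + ?e b $ i = ?e j $ i + ?e k $ i" for i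
    using arg_cong[OF eq, of f] by (metis add fs vector_add_component)
  show ?thesis
    \<comment> \<open>The coordinates at the four indices involved suffice;
      \<open>case_sum id id\<close> forgets the prime.\<close>
    using nz e[of "case_sum id id a"] e[of "case_sum id id b"]
      e[of "case_sum id id j"] e[of "case_sum id id k"]
    by (cases a; cases b; cases j; cases k)
      (auto simp: step_def axis_def split: if_splits)
qed

lemma step_add_step_neq_step: "step v j + step v k \<noteq> step v i"
proof
  assume eq: "step v j + step v k = step v i"
  obtain f :: "real ^ 'n \<Rightarrow> real ^ 'n" where f: "linear f" "\<And>i. f (v i) = axis i 1"
    using coordinates by blast
  interpret linear f by (rule f(1))
  \<comment> \<open>The coordinate sum of a step is odd.\<close>
  let ?s = "\<lambda>x. \<Sum>i\<in>UNIV. f x $ i"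
  have "?s (step v j) + ?s (step v k) = ?s (step v i)"
    unfolding eq[symmetric] by (simp add: add sum.distrib)
  moreover have sgn: "?s (step v x) = 1 \<or> ?s (step v x) = - 1" for x
    by (cases x) (auto simp: step_def f(2) neg axis_def sum_negf)
  ultimately show False
    using sgn[of i] sgn[of j] sgn[of k] by (elim disjE) linarith+
qed

section \<open>The anticommutation relation\<close>

text \<open>The case \<open>j = k\<close> is included: the two paths then coincide and the sum is
  twice a single path.\<close>

lemma two_paths_in_ideal:
  assumes m: "m \<in> L" and nz: "step v j + step v k \<noteq> 0"
  shows "(\<lambda>xs. basis_form [m, m + step v j, m + step v j + step v k] xs +
    basis_form [m, m + step v k, m + step v k + step v j] xs) \<in> J"
proof -
  define q where "q = m + step v j + step v k"
  have "q \<in> L"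
    unfolding q_def by (intro step_in_lattice_pts m)
  then have q: "q \<in> L" "m \<noteq> q" "q = m + step v k + step v j"
    using nz by (auto simp: q_def add_ac)
  let ?f = "\<lambda>l. [m, l, q]"
  let ?g = "{m + step v j, m + step v k}"
  have inj: "inj_on ?f A" for A
    by (rule inj_onI) simp
  have "basis_form [m, q] \<in> J"
    using edge_in_ideal_iff[OF m q(1)] step_add_step_neq_step[of j k] by (auto simp: q_def add.assoc)
  then have "form_mult (basis_form [m]) (form_mult (form_d L (basis_form [m, q])) (basis_form [q])) \<in> J"
    using m q by (intro ideal_mult_left ideal_mult_right d_stable basis_form_in_forms) auto
  then have all: "(\<lambda>xs. - symbol_sum (?f ` L) xs) \<in> J"
    unfolding form_d_edge_sandwich[OF q(2) m q(1)] .
  have rest: "symbol_sum (?f ` (L - ?g)) \<in> J"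
  proof (rule ideal_infinite_sum[OF _ _ has_sum_basis_form[OF inj]])
    fix l assume l: "l \<in> L - ?g"
    show "basis_form [m, l, q] \<in> forms_deg L 2"
      using m q l by (intro basis_form_in_forms_deg) auto
    \<comment> \<open>If both halves were edges, \<open>a\<close> would be \<open>j\<close> or
      \<open>k\<close>, so \<open>l\<close> would be one of the two excluded midpoints.\<close>
    have "False" if "l = m + step v a" "q = l + step v b" for a b
      using step_add_step_eqD[of a b, OF _ nz] that l by (auto simp: q_def add.assoc)
    then have "basis_form [m, l] \<in> J \<or> basis_form [l, q] \<in> J"
      using m q l edge_in_ideal_iff[of m l] edge_in_ideal_iff[of l q] by blast
    then show "basis_form [m, l, q] \<in> J"
      using m q l by (intro path_in_ideal) auto
  qed
  \<comment> \<open>\<open>symbol_sum\<close> counts a set of paths, so coinciding paths need the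
    factor 2.\<close>
  define c :: complex where "c = (if j = k then 2 else 1)"
  have "step v j = step v k \<Longrightarrow> j = k"
    using step_add_step_eqD[of j j k k] step_add_step_eqD[of k k j j] nz by auto
  \<comment> \<open>Adding the remaining paths to minus all paths leaves minus the paths through the
    two special midpoints.\<close>
  then have "basis_form [m, m + step v j, q] xs + basis_form [m, m + step v k, q] xs =
      - c * (- symbol_sum (?f ` L) xs + symbol_sum (?f ` (L - ?g)) xs)" for xs
    using m step_in_lattice_pts[OF m, of j] step_in_lattice_pts[OF m, of k]
    by (auto simp: c_def symbol_sum_def basis_form_def)
  then show ?thesis
    using ideal_scale[OF ideal_add[OF all rest], of "- c"] by (simp flip: q_def q(3))
qed

lemma Theta_eq: "Theta v J j = reduce v J (symbol_sum ((\<lambda>m. [m, m + step v j]) ` L))"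
proof -
  have "inj_on (\<lambda>m. [m, m + step v j]) L"
    by (rule inj_onI) simp
  then show ?thesis
    by (simp add: Theta_def has_sum_basis_form[THEN infsumI])
qed

text \<open>The two products are summed jointly over the starting point \<open>m\<close>, since the
  relation for nonzero \<open>step v j + step v k\<close> puts only the pair of paths, not each
  path, into \<open>J\<close>.\<close>

lemma anticommutator_Theta:
  assumes no_opposite_edges: "\<And>m p. m \<in> L \<Longrightarrow> p \<in> L \<Longrightarrow> basis_form [m, p, m] \<in> J"
  shows "anticommutator (reduction v J) (Theta v J j) (Theta v J k) = \<zero>\<^bsub>reduction v J\<^esub>"
proof -
  let ?T = "\<lambda>j. symbol_sum ((\<lambda>m. [m, m + step v j]) ` L)"
  let ?g = "\<lambda>j k m. [m, m + step v j, m + step v j + step v k]"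
  let ?w = "\<lambda>xs. symbol_sum (?g j k ` L) xs + symbol_sum (?g k j ` L) xs"
  have T: "?T j \<in> forms L" for j
    by (rule subsetD[OF forms_deg_subset_forms[of L 1]], rule symbol_sum_in_forms_deg)
      (auto simp: step_in_lattice_pts)
  have mult: "form_mult (?T j) (?T k) = symbol_sum (?g j k ` L)" for j k
    by (rule form_mult_edge_sums) (rule step_in_lattice_pts)
  have inj: "inj_on (?g j k) L" for j k
    by (rule inj_onI) simp
  have g_sub: "set (?g j k m) \<subseteq> L" if "m \<in> L" for j k m
    using that by (simp add: step_in_lattice_pts)
  have "?w \<in> J"
  proof (rule ideal_infinite_sum)
    fix m assume m: "m \<in> L"
    show "(\<lambda>xs. basis_form (?g j k m) xs + basis_form (?g k j m) xs) \<in> J"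
    proof (cases "step v j + step v k = 0")
      case True
      \<comment> \<open>Both paths return to \<open>m\<close>, so the absence of opposite edges
        applies to each.\<close>
      then have "m + step v j + step v k = m" "m + step v k + step v j = m"
        by (simp_all add: add.assoc add.commute)
      then show ?thesis
        using m by (simp only:) (intro ideal_add no_opposite_edges step_in_lattice_pts)
    qed (use two_paths_in_ideal m in blast)
    show "(\<lambda>xs. basis_form (?g j k m) xs + basis_form (?g k j m) xs) \<in> forms_deg L 2"
      by (intro forms_deg_add basis_form_in_forms_deg g_sub m) simp_all
  next
    fix xs
    show "((\<lambda>m. basis_form (?g j k m) xs + basis_form (?g k j m) xs) has_sum ?w xs) L"
      by (intro has_sum_add has_sum_basis_form inj)
  qed
  then show ?thesis
    using T by (simp add: Theta_eq anticommutator_reduce mult reduce_eq_zero_iff ideal_subset_forms)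
qed

end

theorem theorem3p1:
  fixes v :: "'n::finite \<Rightarrow> real ^ 'n"
    and J :: "((real ^ 'n) list \<Rightarrow> complex) set"
  assumes "symmetric_lattice_reduction v J"
    and no_opposite_edges: "\<And>m p. m \<in> lattice_pts v \<Longrightarrow> p \<in> lattice_pts v \<Longrightarrow>
      reduce v J (basis_form [m, p, m]) = \<zero>\<^bsub>reduction v J\<^esub>"
  shows "\<forall>j k. anticommutator (reduction v J) (Theta v J j) (Theta v J k) = \<zero>\<^bsub>reduction v J\<^esub>"
proof -
  interpret symmetric_lattice_reduction v J by fact
  have "basis_form [m, p, m] \<in> J" if "m \<in> L" "p \<in> L" for m p
    using no_opposite_edges[OF that] reduce_eq_zero_iff basis_form_in_forms[of "[m, p, m]"] that
    by simp
  then show ?thesis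
    by (intro allI anticommutator_Theta)
qed

end
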